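(* Let $\mathscr{A}$ be a $C^*$-algebra, $\mathscr{H}$ a Hilbert $\mathscr{A}$-module, and $A\in\mathcal{L}(\mathscr{H})$. Suppose there is $x\in\mathscr{H}$ with $Ax\neq 0$ such that for every $y\in\mathscr{H}$ the equality $$\|\langle Ax,y\rangle\|=(\|Ax\|\,\|y\|)^{\lambda}(\|Ay\|\,\|x\|)^{1-\lambda}$$ holds for some $\lambda\in(0,1)$. Then $A$ is cohyponormal.
   Context: $\mathcal{L}(\mathscr{H})$ is the $C^*$-algebra of adjointable operators on the Hilbert $C^*$-module $(\mathscr{H},\langle\cdot,\cdot\rangle)$, with norm $\|x\|=\|\langle x,x\rangle\|^{1/2}$ on $\mathscr{H}$. For $A\in\mathcal{L}(\mathscr{H})$, $|A|=(A^*A)^{1/2}$. The operator $A$ is called cohyponormal if $|A|^2\le|A^*|^2$, i.e. $A^*A\le AA^*$, in $\mathcal{L}(\mathscr{H})$. *)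

theory Defs
  imports "HOL-Analysis.Analysis"
begin

section \<open>\<open>C\<^sup>*\<close>-algebras\<close>

class complex_vector = real_vector +
  fixes scaleC :: "complex \<Rightarrow> 'a \<Rightarrow> 'a"  (infixr "*\<^sub>C" 75)
  assumes scaleC_add_right: "c *\<^sub>C (x + y) = c *\<^sub>C x + c *\<^sub>C y"
    and scaleC_add_left: "(c + d) *\<^sub>C x = c *\<^sub>C x + d *\<^sub>C x"
    and scaleC_scaleC: "c *\<^sub>C d *\<^sub>C x = (c * d) *\<^sub>C x"
    and scaleR_scaleC: "r *\<^sub>R x = complex_of_real r *\<^sub>C x"

text \<open>No unit is assumed: the class \<open>real_normed_algebra\<close> contributes an associative
  distributive product with a submultiplicative norm.\<close>

class cstar_algebra = complex_vector + real_normed_algebra + complete_space +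
  fixes cstar :: "'a \<Rightarrow> 'a"  ("_\<^sup>\<star>" [1000] 999)
  assumes mult_scaleC_left: "(c *\<^sub>C a) * b = c *\<^sub>C (a * b)"
    and mult_scaleC_right: "a * (c *\<^sub>C b) = c *\<^sub>C (a * b)"
    and norm_scaleC: "norm (c *\<^sub>C a) = cmod c * norm a"
    and cstar_add: "(a + b)\<^sup>\<star> = a\<^sup>\<star> + b\<^sup>\<star>"
    and cstar_scaleC: "(c *\<^sub>C a)\<^sup>\<star> = cnj c *\<^sub>C a\<^sup>\<star>"
    and cstar_mult: "(a * b)\<^sup>\<star> = b\<^sup>\<star> * a\<^sup>\<star>"
    and cstar_cstar: "(a\<^sup>\<star>)\<^sup>\<star> = a"
    and norm_cstar_mult: "norm (a\<^sup>\<star> * a) = (norm a)\<^sup>2"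

text \<open>Product of the unitization \<open>\<complex> \<oplus> A\<close>, whose unit is \<open>(1, 0)\<close>.\<close>

definition unitization_mult ::
    "complex \<times> 'a::cstar_algebra \<Rightarrow> complex \<times> 'a \<Rightarrow> complex \<times> 'a" where
  "unitization_mult p q =
     (fst p * fst q, fst p *\<^sub>C snd q + fst q *\<^sub>C snd p + snd p * snd q)"

text \<open>The spectrum is taken in the unitization, whether or not \<open>A\<close> has a unit. If it has one, this
  adds at most the point \<open>0\<close> to the spectrum in \<open>A\<close>, which does not affect positivity.\<close>

definition cstar_spectrum :: "'a::cstar_algebra \<Rightarrow> complex set" where
  "cstar_spectrum a =
     {z. \<not> (\<exists>q. unitization_mult (- z, a) q = (1, 0) \<and> unitization_mult q (- z, a) = (1, 0))}"

definition cstar_positive :: "'a::cstar_algebra \<Rightarrow> bool" where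
  "cstar_positive a \<longleftrightarrow> a\<^sup>\<star> = a \<and> cstar_spectrum a \<subseteq> \<real>\<^sub>\<ge>\<^sub>0"


section \<open>Hilbert \<open>C\<^sup>*\<close>-modules\<close>

definition module_norm :: "('h \<Rightarrow> 'h \<Rightarrow> 'a::cstar_algebra) \<Rightarrow> 'h \<Rightarrow> real" where
  "module_norm ip x = sqrt (norm (ip x x))"

text \<open>Right modules, with an inner product that is linear in its second argument. Completeness is
  spelled out because \<^const>\<open>module_norm\<close> is not a priori the norm of a normed space: its triangle
  inequality is a consequence of the axioms. Also \<open>x\<cdot>1 = x\<close> for unital \<open>A\<close> is a consequence.\<close>

locale hilbert_module =
  fixes ract :: "'h::complex_vector \<Rightarrow> 'a::cstar_algebra \<Rightarrow> 'h"  (infixl "\<cdot>" 75)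
    and ip :: "'h \<Rightarrow> 'h \<Rightarrow> 'a"
  assumes ract_add_left: "(x + y) \<cdot> a = x \<cdot> a + y \<cdot> a"
    and ract_add_right: "x \<cdot> (a + b) = x \<cdot> a + x \<cdot> b"
    and ract_mult: "x \<cdot> (a * b) = (x \<cdot> a) \<cdot> b"
    and ract_scaleC_left: "(c *\<^sub>C x) \<cdot> a = c *\<^sub>C (x \<cdot> a)"
    and ract_scaleC_right: "x \<cdot> (c *\<^sub>C a) = c *\<^sub>C (x \<cdot> a)"
    and ip_add_right: "ip x (y + z) = ip x y + ip x z"
    and ip_scaleC_right: "ip x (c *\<^sub>C y) = c *\<^sub>C ip x y"
    and ip_ract_right: "ip x (y \<cdot> a) = ip x y * a"
    and ip_cstar: "(ip x y)\<^sup>\<star> = ip y x"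
    and ip_positive: "cstar_positive (ip x x)"
    and ip_definite: "ip x x = 0 \<Longrightarrow> x = 0"
    and complete_module_norm:
      "(\<forall>e>0. \<exists>M. \<forall>m\<ge>M. \<forall>n\<ge>M. module_norm ip (X m - X n) < e) \<Longrightarrow>
       \<exists>l. (\<lambda>n. module_norm ip (X n - l)) \<longlonglongrightarrow> 0"


section \<open>Adjointable operators\<close>

text \<open>Linearity, \<open>A\<close>-linearity and boundedness of an adjointable map are automatic. The definitions
  below are meant for an inner product \<open>ip\<close> of a Hilbert module.\<close>

definition adjointable :: "('h \<Rightarrow> 'h \<Rightarrow> 'a) \<Rightarrow> ('h \<Rightarrow> 'h) \<Rightarrow> bool" where
  "adjointable ip T \<longleftrightarrow> (\<exists>S. \<forall>x y. ip (T x) y = ip x (S y))"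

definition module_adjoint :: "('h \<Rightarrow> 'h \<Rightarrow> 'a) \<Rightarrow> ('h \<Rightarrow> 'h) \<Rightarrow> 'h \<Rightarrow> 'h" where
  "module_adjoint ip T = (THE S. \<forall>x y. ip (T x) y = ip x (S y))"

lemma (in hilbert_module) module_adjoint:
  assumes "adjointable ip T"
  shows "ip (T x) y = ip x (module_adjoint ip T y)"
proof -
  have diff: "ip x (y - z) = ip x y - ip x z" for x y z
    using ip_add_right[of x "y - z" z] by (simp add: algebra_simps)
  have unique: "S = S'"
    if "\<forall>x y. ip (T x) y = ip x (S y)" "\<forall>x y. ip (T x) y = ip x (S' y)" for S S'
  proof
    fix y
    have "ip x (S y - S' y) = 0" for x
      using that diff by simp
    then show "S y = S' y"
      using ip_definite[of "S y - S' y"] by simp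
  qed
  obtain S where S: "\<forall>x y. ip (T x) y = ip x (S y)"
    using assms unfolding adjointable_def by auto
  have "module_adjoint ip T = S"
    unfolding module_adjoint_def
  proof (rule the_equality)
    show "\<forall>x y. ip (T x) y = ip x (S y)" by (fact S)
    show "S' = S" if "\<forall>x y. ip (T x) y = ip x (S' y)" for S'
      by (fact unique[OF that S])
  qed
  with S show ?thesis by simp
qed

text \<open>The spectrum in the unital \<open>C\<^sup>*\<close>-algebra of adjointable operators.\<close>

definition op_spectrum ::
    "('h::complex_vector \<Rightarrow> 'h \<Rightarrow> 'a) \<Rightarrow> ('h \<Rightarrow> 'h) \<Rightarrow> complex set" where
  "op_spectrum ip T =
     {z. \<not> (\<exists>S. adjointable ip S \<and> S \<circ> (\<lambda>x. T x - z *\<^sub>C x) = id \<and> (\<lambda>x. T x - z *\<^sub>C x) \<circ> S = id)}"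

definition op_positive :: "('h::complex_vector \<Rightarrow> 'h \<Rightarrow> 'a) \<Rightarrow> ('h \<Rightarrow> 'h) \<Rightarrow> bool" where
  "op_positive ip T \<longleftrightarrow>
     adjointable ip T \<and> module_adjoint ip T = T \<and> op_spectrum ip T \<subseteq> \<real>\<^sub>\<ge>\<^sub>0"

definition op_le ::
    "('h::complex_vector \<Rightarrow> 'h \<Rightarrow> 'a) \<Rightarrow> ('h \<Rightarrow> 'h) \<Rightarrow> ('h \<Rightarrow> 'h) \<Rightarrow> bool" where
  "op_le ip S T \<longleftrightarrow> op_positive ip (\<lambda>x. T x - S x)"

definition cohyponormal :: "('h::complex_vector \<Rightarrow> 'h \<Rightarrow> 'a) \<Rightarrow> ('h \<Rightarrow> 'h) \<Rightarrow> bool" where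
  "cohyponormal ip A \<longleftrightarrow> op_le ip (module_adjoint ip A \<circ> A) (A \<circ> module_adjoint ip A)"

end

theory Submission
  imports Defs
begin

text \<open>
  By Cauchy-Schwarz \<open>\<parallel>\<langle>Ax,y\<rangle>\<parallel> \<le> \<parallel>Ax\<parallel> \<parallel>y\<parallel>\<close>. The left-hand side is also a weighted geometric mean of
  the right-hand side and \<open>\<parallel>Ay\<parallel> \<parallel>x\<parallel>\<close>, and a mean that does not exceed one of its two terms
  cannot lie below the other. So
  \<open>\<parallel>Ay\<parallel> \<parallel>x\<parallel> \<le> \<parallel>\<langle>Ax,y\<rangle>\<parallel> = \<parallel>\<langle>x,A\<^sup>*y\<rangle>\<parallel> \<le> \<parallel>x\<parallel> \<parallel>A\<^sup>*y\<parallel>\<close> for every \<open>y\<close>. This bounds \<open>A\<close>, and it gives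
  \<open>\<parallel>Ay\<parallel> \<le> \<parallel>A\<^sup>*y\<parallel>\<close> for all \<open>y\<close>. It remains to conclude that \<open>T = AA\<^sup>* - A\<^sup>*A\<close> has its spectrum in
  \<open>[0,\<infinity>)\<close> (lemma \<open>cohyponormal_if_mnorm_le\<close>).

  For this it suffices to bound \<open>T - z\<close> below in norm, uniformly along a ray that runs from \<open>z\<close> to
  infinity: far out on the ray \<open>T - z\<close> is invertible by a Neumann series, and invertibility then
  propagates back to \<open>z\<close> in steps of fixed length (\<open>surj_shift_along_ray\<close>). For nonreal \<open>z\<close> the
  bound \<open>\<bar>Im z\<bar>\<close> is immediate because \<open>T\<close> is self-adjoint. For \<open>z = -s < 0\<close> put
  \<open>p = \<langle>A\<^sup>*y,A\<^sup>*y\<rangle>\<close>, \<open>q = \<langle>Ay,Ay\<rangle>\<close>, \<open>e = \<langle>y,y\<rangle>\<close> and \<open>d = \<langle>y,(T + s)y\<rangle> = p - q + se\<close>. Boundedness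
  of \<open>A\<close> gives \<open>q \<le> Me\<close> in the algebra for some \<open>M > s\<close>, hence \<open>p \<le> (1 - s/M)q + d\<close>. Together with
  \<open>\<parallel>q\<parallel> \<le> \<parallel>p\<parallel>\<close> this forces \<open>\<parallel>q\<parallel>\<close>, and then \<open>\<parallel>e\<parallel>\<close>, to be at most a constant times \<open>\<parallel>d\<parallel>\<close>
  (\<open>mnorm_shift_ge\<close>).

  The order on the algebra is handled through left multiplication. The notion \<open>accretive\<close> below is
  a norm condition, stable under sums and limits. That spectral positivity implies it, and
  that it controls norms, both rest on the fact that the norm of a self-adjoint operator is its
  spectral radius, here \<open>norm_le_spectral_bound\<close>.
\<close>

section \<open>Scalars and involution\<close>

lemma scaleC_one: "1 *\<^sub>C x = (x::'a::complex_vector)"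
  using scaleR_scaleC[of 1 x] by simp

lemma scaleC_zero_right: "c *\<^sub>C (0::'a::complex_vector) = 0"
  using scaleC_add_right[of c 0 0] by simp

lemma scaleC_zero_left: "0 *\<^sub>C x = (0::'a::complex_vector)"
  using scaleC_add_left[of 0 0 x] by simp

lemma scaleC_minus_right: "c *\<^sub>C (- x) = - (c *\<^sub>C (x::'a::complex_vector))"
  using scaleC_add_right[of c x "- x"] by (simp add: scaleC_zero_right minus_unique)

lemma scaleC_minus_left: "(- c) *\<^sub>C x = - (c *\<^sub>C (x::'a::complex_vector))"
  using scaleC_add_left[of c "- c" x] by (simp add: scaleC_zero_left minus_unique)

lemma scaleC_diff_right: "c *\<^sub>C (x - y) = c *\<^sub>C x - c *\<^sub>C (y::'a::complex_vector)"
  using scaleC_add_right[of c x "- y"] by (simp add: scaleC_minus_right)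

lemma scaleC_diff_left: "(c - d) *\<^sub>C x = c *\<^sub>C x - d *\<^sub>C (x::'a::complex_vector)"
  using scaleC_add_left[of c "- d" x] by (simp add: scaleC_minus_left)

lemma cstar_zero: "(0::'a::cstar_algebra)\<^sup>\<star> = 0"
  using cstar_add[of 0 "0::'a"] by simp

lemma cstar_minus: "(- a)\<^sup>\<star> = - (a::'a::cstar_algebra)\<^sup>\<star>"
  using cstar_add[of a "- a"] by (simp add: cstar_zero minus_unique)

lemma cstar_diff: "(a - b)\<^sup>\<star> = a\<^sup>\<star> - (b::'a::cstar_algebra)\<^sup>\<star>"
  using cstar_add[of a "- b"] by (simp add: cstar_minus)

lemma cstar_scaleR: "(r *\<^sub>R a)\<^sup>\<star> = r *\<^sub>R (a::'a::cstar_algebra)\<^sup>\<star>"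
  by (simp add: scaleR_scaleC cstar_scaleC)

lemma norm_cstar: "norm (a\<^sup>\<star>) = norm (a::'a::cstar_algebra)"
proof -
  have le: "norm b \<le> norm (b\<^sup>\<star>)" for b :: 'a
  proof (cases "b = 0")
    case False
    have "norm b * norm b \<le> norm (b\<^sup>\<star>) * norm b"
      using norm_mult_ineq[of "b\<^sup>\<star>" b] by (simp add: norm_cstar_mult power2_eq_square)
    then show ?thesis using False by simp
  qed simp
  show ?thesis
    using le[of a] le[of "a\<^sup>\<star>"] by (simp add: cstar_cstar)
qed

section \<open>The spectral radius of a self-adjoint operator on the algebra\<close>

text \<open>The assumption says that \<open>a + ib\<close> and \<open>a - ib\<close> both have \<open>a\<^sup>*a + b\<^sup>*b\<close> as their square
  \<open>w\<^sup>*w\<close>, so they have the same norm, and \<open>b\<close> is, up to a factor \<open>i\<close>, half their difference.\<close>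

lemma norm_square_le_sum_of_squares:
  fixes a b :: "'a::cstar_algebra"
  assumes "a\<^sup>\<star> * b = b\<^sup>\<star> * a"
  shows "(norm b)\<^sup>2 \<le> norm (a\<^sup>\<star> * a + b\<^sup>\<star> * b)"
proof -
  define v w where "v = a + \<i> *\<^sub>C b" and "w = a - \<i> *\<^sub>C b"
  have "v\<^sup>\<star> * v = a\<^sup>\<star> * a + b\<^sup>\<star> * b" "w\<^sup>\<star> * w = a\<^sup>\<star> * a + b\<^sup>\<star> * b"
    using assms unfolding v_def w_def
    by (simp_all add: cstar_add cstar_diff cstar_scaleC mult_scaleC_left mult_scaleC_right
        scaleC_scaleC scaleC_add_right scaleC_diff_right scaleC_minus_left scaleC_one algebra_simps)
  then have v: "(norm v)\<^sup>2 = norm (a\<^sup>\<star> * a + b\<^sup>\<star> * b)"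
    and w: "(norm w)\<^sup>2 = norm (a\<^sup>\<star> * a + b\<^sup>\<star> * b)"
    by (metis norm_cstar_mult)+
  then have vw: "norm v = norm w"
    by (metis norm_ge_zero power2_eq_iff_nonneg)
  have "v - w = (2 * \<i>) *\<^sub>C b"
    unfolding v_def w_def by (simp add: scaleC_add_left[symmetric])
  then have "norm (v - w) = 2 * norm b"
    by (simp add: norm_scaleC norm_mult)
  then have "norm b \<le> norm v"
    using norm_triangle_ineq4[of v w] vw by simp
  then show ?thesis
    using v by (metis norm_ge_zero power_mono)
qed

text \<open>Operators \<open>y \<mapsto> ty + ay\<close> with \<open>t\<close> real and \<open>a\<close> self-adjoint are the intended examples. Among
  maps of the algebra the identity serves as a unit, also when the algebra has none.\<close>

definition selfadjoint_map :: "('a::cstar_algebra \<Rightarrow> 'a) \<Rightarrow> bool" where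
  "selfadjoint_map c \<longleftrightarrow> bounded_linear c \<and> (\<forall>y z. (c y)\<^sup>\<star> * z = y\<^sup>\<star> * c z)"

lemma selfadjoint_map_funpow:
  assumes "selfadjoint_map c"
  shows "selfadjoint_map (c ^^ n)"
proof (induction n)
  case 0
  then show ?case by (simp add: selfadjoint_map_def bounded_linear_ident id_def)
next
  case (Suc n)
  have "(c ((c ^^ n) y))\<^sup>\<star> * z = y\<^sup>\<star> * c ((c ^^ n) z)" for y z
    using assms Suc by (simp add: selfadjoint_map_def) (metis funpow_swap1)
  moreover have "bounded_linear (\<lambda>y. c ((c ^^ n) y))"
    using assms Suc bounded_linear_compose unfolding selfadjoint_map_def by blast
  ultimately show ?case
    by (simp add: selfadjoint_map_def o_def)
qed

text \<open>This is the inequality \<open>2\<bar>u\<bar> \<le> 1 + u\<^sup>2\<close> for a real number \<open>u\<close>. It holds because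
  \<open>(1 + u\<^sup>2)\<^sup>2 = (1 - u\<^sup>2)\<^sup>2 + (2u)\<^sup>2\<close>.\<close>

lemma norm_add_square_ge:
  assumes "selfadjoint_map u"
  shows "2 * norm (u y) \<le> norm (y + u (u y))"
proof -
  interpret u: bounded_linear u using assms by (simp add: selfadjoint_map_def)
  have sa: "(u a)\<^sup>\<star> * b = a\<^sup>\<star> * u b" for a b
    using assms by (simp add: selfadjoint_map_def)
  define a b where "a = y - u (u y)" and "b = 2 *\<^sub>R u y"
  have ab: "a\<^sup>\<star> * b = b\<^sup>\<star> * a"
    unfolding a_def b_def
    by (simp add: cstar_diff cstar_scaleR sa u.diff u.scaleR algebra_simps)
  have four: "4 *\<^sub>R v = v + (v + 2 *\<^sub>R v)" for v :: 'a
    using scaleR_add_left[of 2 2 v] by (simp add: scaleR_2)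
  have sum: "a\<^sup>\<star> * a + b\<^sup>\<star> * b = (y + u (u y))\<^sup>\<star> * (y + u (u y))"
    unfolding a_def b_def
    by (simp add: cstar_diff cstar_add cstar_scaleR sa u.diff u.add u.scaleR four scaleR_2 algebra_simps)
  have "(norm b)\<^sup>2 \<le> (norm (y + u (u y)))\<^sup>2"
    using norm_square_le_sum_of_squares[OF ab] unfolding sum norm_cstar_mult .
  then have "norm b \<le> norm (y + u (u y))" by (simp add: power_mono_iff)
  then show ?thesis by (simp add: b_def)
qed

text \<open>The factorization \<open>1 - u\<^sup>2 = (1 + u)(1 - u)\<close> is used with \<open>u = v\<^sup>2\<close> a power of \<open>c\<close>. For a
  contraction \<open>v\<close> the previous lemma yields \<open>\<parallel>(1 + u)z\<parallel> \<ge> 2\<parallel>uz\<parallel>\<close>, so each doubling of the exponent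
  doubles the constant, at the price of a factor \<open>u\<close> on the left. The factors
  \<open>c\<^sup>2, c\<^sup>4, c\<^sup>8, \<dots>\<close> collected in this way multiply to the power of \<open>c\<close> in the statement.\<close>

lemma norm_one_minus_power_ge:
  assumes c: "selfadjoint_map c" and contr: "\<And>y. norm (c y) \<le> norm y"
    and lower: "\<And>y. \<delta> * norm y \<le> norm (y - c (c y))"
  shows "2 ^ k * \<delta> * norm ((c ^^ (2 ^ Suc k - 2)) y) \<le> norm (y - (c ^^ 2 ^ Suc k) y)"
proof (induction k arbitrary: y)
  case 0
  then show ?case using lower by (simp add: numeral_2_eq_2)
next
  case (Suc k)
  define v u where "v = c ^^ 2 ^ k" and "u = c ^^ 2 ^ Suc k"
  have u: "u z = v (v z)" for z
    unfolding u_def v_def by (simp add: mult_2 funpow_add)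
  have v: "selfadjoint_map v" unfolding v_def by (rule selfadjoint_map_funpow[OF c])
  interpret u: bounded_linear u
    using selfadjoint_map_funpow[OF c] by (simp add: u_def selfadjoint_map_def)
  have "norm ((c ^^ n) z) \<le> norm z" for n z
    by (induction n) (auto intro: order_trans[OF contr])
  then have vc: "norm (v z) \<le> norm z" for z by (simp add: v_def)
  have idx: "(c ^^ (2 ^ Suc k - 2)) (u y) = (c ^^ (2 ^ Suc (Suc k) - 2)) y"
  proof -
    have "(2::nat) ^ Suc (Suc k) - 2 = (2 ^ Suc k - 2) + 2 ^ Suc k"
      using one_le_power[of "2::nat" k] by simp
    then show ?thesis by (simp only: funpow_add u_def o_def)
  qed
  have uu: "u (u y) = (c ^^ 2 ^ Suc (Suc k)) y"
    unfolding u_def by (simp add: mult_2 funpow_add)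
  define z where "z = y - u y"
  have "2 * (2 ^ k * \<delta> * norm ((c ^^ (2 ^ Suc k - 2)) (u y))) \<le> 2 * norm (u y - u (u y))"
    using Suc.IH[of "u y"] by (simp add: u_def)
  also have "\<dots> = 2 * norm (v (v z))"
    by (simp add: z_def u.diff flip: u)
  also have "\<dots> \<le> 2 * norm (v z)" using vc by simp
  also have "\<dots> \<le> norm (z + u z)" using norm_add_square_ge[OF v] by (simp add: u)
  also have "\<dots> = norm (y - u (u y))" by (simp add: z_def u.diff)
  finally show ?case
    unfolding idx uu by (simp add: mult.assoc)
qed

text \<open>The operator norm of \<open>c\<^sup>2\<close> is the square of that of \<open>c\<close>, stated at a single vector: iterate
  \<open>\<parallel>vy\<parallel>\<^sup>2 = \<parallel>y\<^sup>* v\<^sup>2 y\<parallel> \<le> \<parallel>y\<parallel> \<parallel>v\<^sup>2 y\<parallel>\<close>.\<close>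

lemma norm_power_le:
  assumes c: "selfadjoint_map c"
  shows "norm (c y) ^ 2 ^ k * norm y \<le> norm ((c ^^ 2 ^ k) y) * norm y ^ 2 ^ k"
proof (induction k)
  case 0
  then show ?case by simp
next
  case (Suc k)
  define v where "v = c ^^ 2 ^ k"
  have v: "(v y)\<^sup>\<star> * v y = y\<^sup>\<star> * v (v y)"
    using selfadjoint_map_funpow[OF c] by (simp add: v_def selfadjoint_map_def)
  have sq: "(norm (v y))\<^sup>2 \<le> norm y * norm (v (v y))"
    using norm_mult_ineq[of "y\<^sup>\<star>" "v (v y)"]
    by (simp add: norm_cstar flip: norm_cstar_mult v)
  show ?case
  proof (cases "norm y = 0")
    case False
    have "(norm (c y) ^ 2 ^ k * norm y)\<^sup>2 \<le> (norm (v y) * norm y ^ 2 ^ k)\<^sup>2"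
      using Suc by (intro power_mono) (auto simp: v_def)
    also have "\<dots> = (norm (v y))\<^sup>2 * (norm y ^ 2 ^ k)\<^sup>2" by (simp add: power_mult_distrib)
    also have "\<dots> \<le> (norm y * norm (v (v y))) * (norm y ^ 2 ^ k)\<^sup>2"
      using sq by (intro mult_right_mono) auto
    finally have "norm y * (norm (c y) ^ 2 ^ Suc k * norm y)
        \<le> norm y * (norm (v (v y)) * norm y ^ 2 ^ Suc k)"
      by (simp add: power_mult_distrib power2_eq_square mult_2 power_add mult_ac)
    then have "norm (c y) ^ 2 ^ Suc k * norm y \<le> norm (v (v y)) * norm y ^ 2 ^ Suc k"
      using False by simp
    then show ?thesis by (simp add: v_def mult_2 funpow_add)
  qed simp
qed

text \<open>The left-hand side of \<open>norm_one_minus_power_ge\<close> grows like \<open>2\<^sup>k\<close> unless the powers of \<open>c\<close>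
  decay, while the right-hand side is at most \<open>2\<parallel>y\<parallel>\<close>. Hence some power of \<open>c\<close> has norm at most
  \<open>1/2\<close>, which by \<open>norm_power_le\<close> bounds the norm of \<open>c\<close> by a root of \<open>1/2\<close>.\<close>

lemma strict_contraction:
  assumes c: "selfadjoint_map c" and contr: "\<And>y. norm (c y) \<le> norm y"
    and "\<delta> > 0" and lower: "\<And>y. \<delta> * norm y \<le> norm (y - c (c y))"
  shows "\<exists>\<rho>\<ge>0. \<rho> < 1 \<and> (\<forall>y. norm (c y) \<le> \<rho> * norm y)"
proof -
  \<comment> \<open>The constant 4 beats the trivial bound 2 on \<open>1 - c\<^sup>m\<close> by the factor 2 that is to be gained.\<close>
  obtain k where k: "4 / \<delta> < 2 ^ k" using real_arch_pow[of 2 "4 / \<delta>"] by auto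
  then have k4: "4 \<le> 2 ^ k * \<delta>" using \<open>\<delta> > 0\<close> by (simp add: field_simps)
  define m :: nat where "m = 2 ^ Suc k"
  have m: "m > 0" by (simp add: m_def)
  have pc: "norm ((c ^^ n) z) \<le> norm z" for n z
    by (induction n) (auto intro: order_trans[OF contr])
  have half: "norm ((c ^^ m) y) \<le> norm y / 2" for y
  proof -
    have "2 \<le> m" by (simp add: m_def)
    then have "2 + (m - 2) = m" by (rule le_add_diff_inverse)
    then have "c ^^ m = c ^^ 2 \<circ> c ^^ (m - 2)"
      using funpow_add[of 2 "m - 2" c] by (simp only:)
    then have "norm ((c ^^ m) y) \<le> norm ((c ^^ (m - 2)) y)"
      using pc[of 2 "(c ^^ (m - 2)) y"] by (simp only: o_apply)
    then have "4 * norm ((c ^^ m) y) \<le> 4 * norm ((c ^^ (m - 2)) y)" by simp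
    also have "\<dots> \<le> 2 ^ k * \<delta> * norm ((c ^^ (m - 2)) y)"
      using k4 by (intro mult_right_mono) auto
    also have "\<dots> \<le> norm (y - (c ^^ m) y)"
      using norm_one_minus_power_ge[OF c contr lower] by (simp add: m_def)
    also have "\<dots> \<le> norm y + norm ((c ^^ m) y)" by (rule norm_triangle_ineq4)
    also have "\<dots> \<le> 2 * norm y" using pc[of m y] by simp
    finally show ?thesis by simp
  qed
  have "norm (c y) \<le> root m (1 / 2) * norm y" for y
  proof (cases "y = 0")
    case True
    then show ?thesis using contr[of y] by simp
  next
    case False
    have "norm (c y) ^ m * norm y \<le> norm ((c ^^ m) y) * norm y ^ m"
      unfolding m_def by (rule norm_power_le[OF c])
    also have "\<dots> \<le> norm y / 2 * norm y ^ m"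
      using half by (intro mult_right_mono) auto
    finally have "norm (c y) ^ m \<le> norm y ^ m / 2" using False by simp
    also have "\<dots> = (root m (1 / 2) * norm y) ^ m"
      using m by (simp add: power_mult_distrib real_root_pow_pos2)
    finally show ?thesis using m by (simp add: power_mono_iff)
  qed
  moreover have "0 \<le> root m (1 / 2)" "root m (1 / 2) < 1" using m by simp_all
  ultimately show ?thesis by blast
qed

text \<open>If the operator norm
  \<open>N\<close> exceeded \<open>D\<close>, then \<open>1 - (c/N)\<^sup>2 = (1 - c/N)(1 + c/N)\<close> would be bounded below, and \<open>c/N\<close> would
  have norm less than 1.\<close>

lemma norm_le_spectral_bound:
  assumes c: "selfadjoint_map c" and "0 \<le> D"
    and minus: "\<And>t. D < t \<Longrightarrow> \<exists>\<delta>>0. \<forall>y. \<delta> * norm y \<le> norm (t *\<^sub>R y - c y)"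
    and plus: "\<And>t. D < t \<Longrightarrow> \<exists>\<delta>>0. \<forall>y. \<delta> * norm y \<le> norm (t *\<^sub>R y + c y)"
  shows "norm (c y) \<le> D * norm y"
proof -
  interpret c: bounded_linear c using c by (simp add: selfadjoint_map_def)
  define N where "N = onorm c"
  have onorm: "norm (c y) \<le> N * norm y" for y
    unfolding N_def by (rule onorm[OF c.bounded_linear_axioms])
  have "N \<le> D"
  proof (rule ccontr)
    assume "\<not> N \<le> D"
    then have N: "D < N" "0 < N" using \<open>0 \<le> D\<close> by auto
    obtain \<delta> where \<delta>: "\<delta> > 0" "\<And>y. \<delta> * norm y \<le> norm (N *\<^sub>R y - c y)"
      using minus[OF N(1)] by auto
    obtain \<epsilon> where \<epsilon>: "\<epsilon> > 0" "\<And>y. \<epsilon> * norm y \<le> norm (N *\<^sub>R y + c y)"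
      using plus[OF N(1)] by auto
    define b where "b = (\<lambda>y. (1 / N) *\<^sub>R c y)"
    have "bounded_linear b"
      unfolding b_def by (intro bounded_linear_scaleR_right[THEN bounded_linear_compose]
          c.bounded_linear_axioms)
    then have b: "selfadjoint_map b"
      using c by (simp add: selfadjoint_map_def b_def cstar_scaleR)
    have contr: "norm (b y) \<le> norm y" for y
      using onorm[of y] N by (simp add: b_def field_simps)
    have lower: "\<delta> * \<epsilon> / N\<^sup>2 * norm y \<le> norm (y - b (b y))" for y
    proof -
      have eq: "N *\<^sub>R (N *\<^sub>R y + c y) - c (N *\<^sub>R y + c y) = N\<^sup>2 *\<^sub>R (y - b (b y))"
        using N by (simp add: b_def c.add c.scaleR algebra_simps power2_eq_square)
      have "\<delta> * (\<epsilon> * norm y) \<le> \<delta> * norm (N *\<^sub>R y + c y)"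
        using \<delta>(1) \<epsilon>(2) by (intro mult_left_mono) auto
      also have "\<dots> \<le> norm (N\<^sup>2 *\<^sub>R (y - b (b y)))"
        using \<delta>(2)[of "N *\<^sub>R y + c y"] unfolding eq .
      also have "\<dots> = N\<^sup>2 * norm (y - b (b y))" by simp
      finally show ?thesis using N by (simp add: divide_le_eq mult_ac)
    qed
    have "0 < \<delta> * \<epsilon> / N\<^sup>2" using \<delta> \<epsilon> N by simp
    from strict_contraction[OF b contr this lower]
    obtain \<rho> where \<rho>: "0 \<le> \<rho>" "\<rho> < 1" "\<And>y. norm (b y) \<le> \<rho> * norm y" by auto
    have "norm (c y) \<le> (N * \<rho>) * norm y" for y
      using \<rho>(3)[of y] N by (simp add: b_def field_simps)
    then have "N \<le> N * \<rho>"
      using \<rho>(1) N by (subst (1) N_def) (intro onorm_bound, auto)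
    then show False using \<rho>(2) N by simp
  qed
  then show ?thesis
    using onorm[of y] by (meson mult_right_mono norm_ge_zero order_trans)
qed

section \<open>Positivity as a norm condition\<close>

text \<open>The condition says that \<open>t + a\<close> is bounded below by \<open>t\<close>, as for a positive number \<open>a\<close>. For
  self-adjoint \<open>a\<close> it is equivalent to \<open>\<parallel>T - a\<parallel> \<le> T\<close> for one, or for all, \<open>T \<ge> \<parallel>a\<parallel>\<close>. The first form
  is closed under limits, the second under sums.\<close>

definition accretive :: "'a::cstar_algebra \<Rightarrow> bool" where
  "accretive a \<longleftrightarrow> a\<^sup>\<star> = a \<and> (\<forall>t\<ge>0. \<forall>y. t * norm y \<le> norm (t *\<^sub>R y + a * y))"

lemma selfadjoint_map_shift:
  fixes a :: "'a::cstar_algebra"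
  assumes "a\<^sup>\<star> = a"
  shows "selfadjoint_map (\<lambda>y. t *\<^sub>R y + a * y)"
  using assms
  by (auto simp: selfadjoint_map_def cstar_add cstar_scaleR cstar_mult algebra_simps
      intro!: bounded_linear_add bounded_linear_scaleR_right bounded_linear_mult_right)

text \<open>The operator \<open>T - a\<close> has no spectrum below \<open>-T\<close>, because \<open>T \<ge> \<parallel>a\<parallel>\<close>, and none above
  \<open>T\<close>, because \<open>t + a\<close> is bounded below for \<open>t > 0\<close>.\<close>

lemma norm_shift_le:
  fixes a :: "'a::cstar_algebra"
  assumes sa: "a\<^sup>\<star> = a" and T: "norm a \<le> T"
    and lower: "\<And>t. 0 < t \<Longrightarrow> \<exists>\<delta>>0. \<forall>y. \<delta> * norm y \<le> norm (t *\<^sub>R y + a * y)"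
  shows "norm (T *\<^sub>R y - a * y) \<le> T * norm y"
proof -
  have 1: "selfadjoint_map (\<lambda>y. T *\<^sub>R y + (- a) * y)"
    by (rule selfadjoint_map_shift) (simp add: sa cstar_minus)
  have 2: "\<exists>\<delta>>0. \<forall>y. \<delta> * norm y \<le> norm (t *\<^sub>R y - (T *\<^sub>R y + (- a) * y))" if "T < t" for t
    using lower[of "t - T"] that by (simp add: algebra_simps)
  have 3: "\<exists>\<delta>>0. \<forall>y. \<delta> * norm y \<le> norm (t *\<^sub>R y + (T *\<^sub>R y + (- a) * y))" if "T < t" for t
  proof (intro exI conjI allI)
    show t: "0 < t" using that T norm_ge_zero[of a] by linarith
    fix y
    have "norm (a * y) \<le> T * norm y"
      by (meson T mult_right_mono norm_ge_zero norm_mult_ineq order_trans)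
    moreover have "norm ((t + T) *\<^sub>R y) \<le> norm ((t + T) *\<^sub>R y - a * y) + norm (a * y)"
      by (metis diff_add_cancel norm_triangle_ineq)
    moreover have "norm ((t + T) *\<^sub>R y) = t * norm y + T * norm y"
      using t order_trans[OF norm_ge_zero T] by (simp add: abs_of_nonneg distrib_right)
    ultimately show "t * norm y \<le> norm (t *\<^sub>R y + (T *\<^sub>R y + (- a) * y))"
      by (simp add: algebra_simps)
  qed
  have "norm (T *\<^sub>R y + (- a) * y) \<le> T * norm y"
    by (rule norm_le_spectral_bound[OF 1 _ 2 3]) (use T norm_ge_zero[of a] in linarith)
  then show ?thesis by simp
qed

lemma accretive_norm_le:
  assumes "accretive a" and "norm a \<le> T"
  shows "norm (T *\<^sub>R y - a * y) \<le> T * norm y"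
proof (rule norm_shift_le)
  show "\<exists>\<delta>>0. \<forall>y. \<delta> * norm y \<le> norm (t *\<^sub>R y + a * y)" if "0 < t" for t
    using assms(1) that by (intro exI[of _ t]) (simp add: accretive_def)
qed (use assms in \<open>simp_all add: accretive_def\<close>)

lemma accretiveI:
  fixes a :: "'a::cstar_algebra"
  assumes sa: "a\<^sup>\<star> = a" and le: "\<And>y. norm (T *\<^sub>R y - a * y) \<le> T * norm y"
    and T: "0 \<le> T"
  shows "accretive a"
  unfolding accretive_def
proof (intro conjI allI impI sa)
  fix t :: real and y
  assume "0 \<le> t"
  then have "t * norm y + T * norm y = norm ((t *\<^sub>R y + a * y) + (T *\<^sub>R y - a * y))"
    using T by (simp add: algebra_simps flip: scaleR_add_left)
  then show "t * norm y \<le> norm (t *\<^sub>R y + a * y)"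
    using norm_triangle_ineq[of "t *\<^sub>R y + a * y" "T *\<^sub>R y - a * y"] le[of y] by linarith
qed

lemma accretive_add:
  assumes "accretive a" "accretive b"
  shows "accretive (a + b)"
proof (rule accretiveI[where T = "norm a + norm b"])
  show "(a + b)\<^sup>\<star> = a + b" using assms by (simp add: accretive_def cstar_add)
  fix y
  have eq: "(norm a + norm b) *\<^sub>R y - (a + b) * y
      = (norm a *\<^sub>R y - a * y) + (norm b *\<^sub>R y - b * y)"
    by (simp add: algebra_simps)
  show "norm ((norm a + norm b) *\<^sub>R y - (a + b) * y) \<le> (norm a + norm b) * norm y"
    unfolding eq distrib_right[of "norm a"] using norm_triangle_ineq[of "norm a *\<^sub>R y - a * y" "norm b *\<^sub>R y - b * y"]
      accretive_norm_le[OF assms(1) order_refl, of y] accretive_norm_le[OF assms(2) order_refl, of y]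
    by linarith
qed simp

lemma accretive_scaleR:
  assumes "accretive a" "0 \<le> r"
  shows "accretive (r *\<^sub>R a)"
proof (rule accretiveI[where T = "r * norm a"])
  show "(r *\<^sub>R a)\<^sup>\<star> = r *\<^sub>R a" using assms by (simp add: accretive_def cstar_scaleR)
  fix y
  have "(r * norm a) *\<^sub>R y - (r *\<^sub>R a) * y = r *\<^sub>R (norm a *\<^sub>R y - a * y)"
    by (simp add: algebra_simps)
  then show "norm ((r * norm a) *\<^sub>R y - (r *\<^sub>R a) * y) \<le> r * norm a * norm y"
    using accretive_norm_le[OF assms(1) order_refl, of y] assms(2)
    by (simp add: mult_left_mono mult.assoc)
qed (use assms in simp)

lemma bounded_linear_cstar: "bounded_linear (cstar :: 'a::cstar_algebra \<Rightarrow> 'a)"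
  by (rule bounded_linear_intro[where K = 1]) (simp_all add: cstar_add cstar_scaleR norm_cstar)

lemma accretive_limit:
  assumes acc: "\<And>n. accretive (a n)" and lim: "a \<longlonglongrightarrow> l"
  shows "accretive l"
  unfolding accretive_def
proof (intro conjI allI impI)
  have "(\<lambda>n. (a n)\<^sup>\<star>) \<longlonglongrightarrow> l\<^sup>\<star>"
    using lim by (rule bounded_linear.tendsto[OF bounded_linear_cstar])
  then have "a \<longlonglongrightarrow> l\<^sup>\<star>" using acc by (simp add: accretive_def)
  then show "l\<^sup>\<star> = l" using lim LIMSEQ_unique by blast
  fix t :: real and y
  assume "0 \<le> t"
  then have "t * norm y \<le> norm (t *\<^sub>R y + a n * y)" for n
    using acc by (auto simp: accretive_def)
  moreover have "(\<lambda>n. norm (t *\<^sub>R y + a n * y)) \<longlonglongrightarrow> norm (t *\<^sub>R y + l * y)"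
    by (intro tendsto_intros lim)
  ultimately show "t * norm y \<le> norm (t *\<^sub>R y + l * y)"
    by (intro LIMSEQ_le_const) auto
qed

text \<open>In terms of the order, \<open>-s \<le> c \<le> r\<close> bounds \<open>\<parallel>c\<parallel>\<close> by the larger of \<open>\<parallel>r\<parallel>\<close> and \<open>\<parallel>s\<parallel>\<close>.
  For \<open>t > D\<close> the operator \<open>t - c = (t - r) + (r - c)\<close> is bounded below by \<open>t - D\<close>, and likewise
  \<open>t + c\<close>, so the spectrum of \<open>c\<close> lies in \<open>[-D,D]\<close>.\<close>

lemma norm_le_if_accretive:
  fixes c :: "'a::cstar_algebra"
  assumes up: "accretive (r - c)" and low: "accretive (s + c)" and sa: "c\<^sup>\<star> = c"
    and r: "norm r \<le> D" and s: "norm s \<le> D"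
  shows "norm c \<le> D"
proof -
  have D: "0 \<le> D" using r norm_ge_zero[of r] by linarith
  have lower: "(t - D) * norm y \<le> norm (t *\<^sub>R y + b * y)"
    if acc: "accretive (a + b)" and a: "norm a \<le> D" and t: "D < t" for a b y :: 'a and t
  proof -
    define T where "T = norm (a + b)"
    have "(t + T) *\<^sub>R y = (t *\<^sub>R y + b * y) + (T *\<^sub>R y - (a + b) * y) + a * y"
      by (simp add: algebra_simps)
    then have "norm ((t + T) *\<^sub>R y)
        \<le> norm (t *\<^sub>R y + b * y) + norm (T *\<^sub>R y - (a + b) * y) + norm (a * y)"
      by (metis norm_triangle_le add_right_mono norm_triangle_ineq)
    moreover have "norm ((t + T) *\<^sub>R y) = t * norm y + T * norm y"
      using t D by (simp add: T_def distrib_right)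
    moreover have "norm (T *\<^sub>R y - (a + b) * y) \<le> T * norm y"
      unfolding T_def by (rule accretive_norm_le[OF acc order_refl])
    moreover have "norm (a * y) \<le> D * norm y"
      by (meson a mult_right_mono norm_ge_zero norm_mult_ineq order_trans)
    ultimately show ?thesis by (simp add: algebra_simps)
  qed
  have 1: "selfadjoint_map (\<lambda>y. c * y)"
    using selfadjoint_map_shift[OF sa, of 0] by simp
  have 2: "\<exists>\<delta>>0. \<forall>y. \<delta> * norm y \<le> norm (t *\<^sub>R y - c * y)" if "D < t" for t
    using lower[of r "- c" t] up r that by (intro exI[of _ "t - D"]) auto
  have 3: "\<exists>\<delta>>0. \<forall>y. \<delta> * norm y \<le> norm (t *\<^sub>R y + c * y)" if "D < t" for t
    using lower[of s c t] low s that by (intro exI[of _ "t - D"]) auto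
  have "norm (c * c) \<le> D * norm c"
    by (rule norm_le_spectral_bound[OF 1 D 2 3])
  then have "norm c * norm c \<le> D * norm c"
    using norm_cstar_mult[of c] sa by (simp add: power2_eq_square)
  then show ?thesis using D by (cases "c = 0") auto
qed

text \<open>An inverse \<open>(z,b)\<close> of \<open>(t,a)\<close> in the unitization acts on the algebra by left
  multiplication, which bounds \<open>t + a\<close> below.\<close>

lemma accretive_if_cstar_positive:
  fixes a :: "'a::cstar_algebra"
  assumes "cstar_positive a"
  shows "accretive a"
proof (rule accretiveI)
  show sa: "a\<^sup>\<star> = a" using assms by (simp add: cstar_positive_def)
  show "norm (norm a *\<^sub>R y - a * y) \<le> norm a * norm y" for y
  proof (rule norm_shift_le[OF sa order_refl])
    fix t :: real
    assume "0 < t"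
    then have "- complex_of_real t \<notin> cstar_spectrum a"
      using assms by (auto simp: cstar_positive_def complex_nonneg_Reals_iff)
    then obtain z b where q: "unitization_mult (z, b) (complex_of_real t, a) = (1, 0)"
      unfolding cstar_spectrum_def by fastforce
    then have zt: "z * of_real t = 1" and zb: "z *\<^sub>C a + of_real t *\<^sub>C b + b * a = 0"
      by (simp_all add: unitization_mult_def)
    define K where "K = 1 + cmod z + norm b"
    have K: "0 < K" by (simp add: K_def add_pos_nonneg)
    have "norm y \<le> K * norm (t *\<^sub>R y + a * y)" for y
    proof -
      define w where "w = t *\<^sub>R y + a * y"
      have "z *\<^sub>C w + b * w = (z * of_real t) *\<^sub>C y + (z *\<^sub>C a + of_real t *\<^sub>C b + b * a) * y"
        by (simp add: w_def scaleR_scaleC scaleC_add_right scaleC_scaleC mult_scaleC_left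
            mult_scaleC_right algebra_simps)
      then have "y = z *\<^sub>C w + b * w" by (simp add: zt zb scaleC_one)
      then have "norm y \<le> cmod z * norm w + norm b * norm w"
        by (metis norm_triangle_le add_mono norm_scaleC norm_mult_ineq order_refl)
      also have "\<dots> \<le> K * norm w" by (simp add: K_def algebra_simps)
      finally show ?thesis by (simp add: w_def)
    qed
    then show "\<exists>\<delta>>0. \<forall>y. \<delta> * norm y \<le> norm (t *\<^sub>R y + a * y)"
      using K by (intro exI[of _ "1 / K"]) (auto simp: field_simps)
  qed
qed simp

section \<open>The norm of a Hilbert module\<close>

context hilbert_module
begin

abbreviation mnorm :: "'h \<Rightarrow> real" where "mnorm \<equiv> module_norm ip"

lemma ip_zero_right: "ip x 0 = 0"
  using ip_add_right[of x 0 0] by simp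

lemma ip_diff_right: "ip x (y - z) = ip x y - ip x z"
  using ip_add_right[of x "y - z" z] by (simp add: algebra_simps)

lemma ip_scaleR_right: "ip x (r *\<^sub>R y) = r *\<^sub>R ip x y"
  by (simp add: scaleR_scaleC ip_scaleC_right)

lemma ip_add_left: "ip (x + y) z = ip x z + ip y z"
  by (metis cstar_add ip_add_right ip_cstar)

lemma ip_diff_left: "ip (x - y) z = ip x z - ip y z"
  by (metis cstar_diff ip_diff_right ip_cstar)

lemma ip_scaleC_left: "ip (c *\<^sub>C x) y = cnj c *\<^sub>C ip x y"
  by (metis cstar_scaleC ip_scaleC_right ip_cstar)

lemma ip_scaleR_left: "ip (r *\<^sub>R x) y = r *\<^sub>R ip x y"
  by (simp add: scaleR_scaleC ip_scaleC_left)

lemma ip_ract_left: "ip (x \<cdot> a) y = a\<^sup>\<star> * ip x y"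
  by (metis cstar_mult ip_ract_right ip_cstar)

lemma ip_ext: "(\<And>z. ip z x = ip z y) \<Longrightarrow> x = y"
  using ip_definite[of "x - y"] by (simp add: ip_diff_right)

lemma accretive_ip: "accretive (ip x x)"
  by (rule accretive_if_cstar_positive[OF ip_positive])

lemma mnorm_nonneg: "0 \<le> mnorm x"
  by (simp add: module_norm_def)

lemma mnorm_square: "(mnorm x)\<^sup>2 = norm (ip x x)"
  by (simp add: module_norm_def)

lemma mnorm_eq_0_iff: "mnorm x = 0 \<longleftrightarrow> x = 0"
  using ip_definite by (auto simp: module_norm_def ip_zero_right)

lemma mnorm_pos_iff: "0 < mnorm x \<longleftrightarrow> x \<noteq> 0"
  using mnorm_eq_0_iff mnorm_nonneg[of x] by (auto simp: less_le)

lemma mnorm_scaleC: "mnorm (c *\<^sub>C x) = cmod c * mnorm x"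
  by (simp add: module_norm_def ip_scaleC_left ip_scaleC_right norm_scaleC real_sqrt_mult
      flip: mult.assoc)

lemma mnorm_scaleR: "mnorm (r *\<^sub>R x) = \<bar>r\<bar> * mnorm x"
  by (simp add: scaleR_scaleC mnorm_scaleC)

lemma mnorm_minus: "mnorm (- x) = mnorm x"
  using mnorm_scaleR[of "- 1" x] by simp

lemma mnorm_ract_le: "mnorm (x \<cdot> a) \<le> mnorm x * norm a"
proof (rule power2_le_imp_le)
  have "(mnorm (x \<cdot> a))\<^sup>2 = norm (a\<^sup>\<star> * (ip x x * a))"
    by (simp add: mnorm_square ip_ract_left ip_ract_right mult.assoc)
  also have "\<dots> \<le> norm a * (norm (ip x x) * norm a)"
    using order_trans[OF norm_mult_ineq[of "a\<^sup>\<star>" "ip x x * a"]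
        mult_left_mono[OF norm_mult_ineq[of "ip x x" a] norm_ge_zero[of "a\<^sup>\<star>"]]]
    by (simp only: norm_cstar)
  finally show "(mnorm (x \<cdot> a))\<^sup>2 \<le> (mnorm x * norm a)\<^sup>2"
    by (simp add: power_mult_distrib mnorm_square) (simp add: power2_eq_square mult_ac)
qed (simp add: mnorm_nonneg)

text \<open>Positivity of \<open>\<langle>u + v,u + v\<rangle>\<close> and \<open>\<langle>u - v,u - v\<rangle>\<close> bounds \<open>2\<langle>u,v\<rangle>\<close> from both sides by
  \<open>\<langle>u,u\<rangle> + \<langle>v,v\<rangle>\<close>.\<close>

lemma norm_ip_le_if_selfadjoint:
  assumes "ip y x = ip x y"
  shows "norm (ip x y) \<le> mnorm x * mnorm y"
proof -
  have unit: "norm (ip u v) \<le> 1" if sa: "ip v u = ip u v" and "mnorm u = 1" "mnorm v = 1" for u v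
  proof -
    define r where "r = ip u u + ip v v"
    have "norm (ip u u) = 1" "norm (ip v v) = 1"
      using that by (simp_all flip: mnorm_square)
    then have r: "norm r \<le> 2"
      unfolding r_def using norm_triangle_ineq[of "ip u u" "ip v v"] by simp
    have "ip (u - v) (u - v) = r - 2 *\<^sub>R ip u v" "ip (u + v) (u + v) = r + 2 *\<^sub>R ip u v"
      using sa by (simp_all add: r_def ip_diff_left ip_diff_right ip_add_left ip_add_right scaleR_2)
    then have "accretive (r - 2 *\<^sub>R ip u v)" "accretive (r + 2 *\<^sub>R ip u v)"
      using accretive_ip[of "u - v"] accretive_ip[of "u + v"] by simp_all
    moreover have "(2 *\<^sub>R ip u v)\<^sup>\<star> = 2 *\<^sub>R ip u v"
      using sa by (simp add: cstar_scaleR ip_cstar)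
    ultimately have "norm (2 *\<^sub>R ip u v) \<le> 2"
      using r by (blast intro: norm_le_if_accretive)
    then show ?thesis by simp
  qed
  show ?thesis
  proof (cases "x = 0 \<or> y = 0")
    case True
    then show ?thesis
      using assms by (auto simp: ip_zero_right mnorm_nonneg)
  next
    case False
    then have pos: "0 < mnorm x" "0 < mnorm y" by (simp_all add: mnorm_pos_iff)
    have "norm (ip ((1 / mnorm x) *\<^sub>R x) ((1 / mnorm y) *\<^sub>R y)) \<le> 1"
      using pos assms by (intro unit) (simp_all add: mnorm_scaleR ip_scaleR_left ip_scaleR_right)
    then show ?thesis
      using pos by (simp add: ip_scaleR_left ip_scaleR_right field_simps)
  qed
qed

text \<open>With \<open>b = \<langle>x,y\<rangle>\<close>, the product \<open>b\<^sup>*b = \<langle>xb,y\<rangle>\<close> is a self-adjoint value of the inner product, so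
  the special case above applies to it.\<close>

lemma norm_ip_le: "norm (ip x y) \<le> mnorm x * mnorm y"
proof (cases "ip x y = 0")
  case False
  define b where "b = ip x y"
  have "(norm b)\<^sup>2 = norm (ip (x \<cdot> b) y)"
    by (simp add: ip_ract_left b_def flip: norm_cstar_mult)
  also have "\<dots> \<le> mnorm (x \<cdot> b) * mnorm y"
  proof (rule norm_ip_le_if_selfadjoint)
    have "ip y (x \<cdot> b) = ip y x * b" by (rule ip_ract_right)
    also have "\<dots> = ip (x \<cdot> b) y"
      by (simp add: ip_ract_left b_def ip_cstar)
    finally show "ip y (x \<cdot> b) = ip (x \<cdot> b) y" .
  qed
  also have "\<dots> \<le> (mnorm x * norm b) * mnorm y"
    by (intro mult_right_mono mnorm_ract_le mnorm_nonneg)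
  finally have "norm b * norm b \<le> norm b * (mnorm x * mnorm y)"
    by (simp add: power2_eq_square mult_ac)
  then show ?thesis using False by (simp add: b_def)
qed (simp add: mnorm_nonneg)

lemma mnorm_triangle: "mnorm (x + y) \<le> mnorm x + mnorm y"
proof (rule power2_le_imp_le)
  have "(mnorm (x + y))\<^sup>2 = norm (ip x x + ip x y + (ip y x + ip y y))"
    by (simp add: mnorm_square ip_add_left ip_add_right ac_simps)
  also have "\<dots> \<le> norm (ip x x) + norm (ip x y) + (norm (ip y x) + norm (ip y y))"
    by (meson norm_triangle_le add_mono norm_triangle_ineq)
  also have "\<dots> \<le> (mnorm x)\<^sup>2 + mnorm x * mnorm y + (mnorm y * mnorm x + (mnorm y)\<^sup>2)"
    using norm_ip_le[of x y] norm_ip_le[of y x] unfolding mnorm_square by linarith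
  finally show "(mnorm (x + y))\<^sup>2 \<le> (mnorm x + mnorm y)\<^sup>2"
    by (simp add: power2_eq_square algebra_simps)
qed (simp add: mnorm_nonneg)

lemma mnorm_triangle_diff: "mnorm (x - y) \<le> mnorm x + mnorm y"
  using mnorm_triangle[of x "- y"] by (simp add: mnorm_minus)

section \<open>Adjointable operators and the order\<close>

text \<open>With \<open>q\<^sub>m = \<langle>y,S\<^sup>m y\<rangle>\<close>, positivity of \<open>\<langle>y - S\<^sup>m y,y - S\<^sup>m y\<rangle>\<close> says \<open>2q\<^sub>m \<le> \<langle>y,y\<rangle> + q\<^sub>2\<^sub>m\<close>. Iterating over
  the powers \<open>m = 2\<^sup>n\<close> gives \<open>q\<^sub>1 \<le> (1 - 2\<^sup>-\<^sup>n)\<langle>y,y\<rangle> + 2\<^sup>-\<^sup>n q\<^sub>m\<close>, where the last term tends to 0 in norm.\<close>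

lemma accretive_ip_diff_contraction:
  assumes sym: "\<And>u v. ip (S u) v = ip u (S v)" and contr: "\<And>u. mnorm (S u) \<le> mnorm u"
  shows "accretive (ip y y - ip y (S y))"
proof -
  define q where "q n = ip y ((S ^^ 2 ^ n) y)" for n
  have symp: "ip ((S ^^ n) u) v = ip u ((S ^^ n) v)" for n u v
  proof (induction n arbitrary: v)
    case (Suc n)
    then show ?case using funpow_swap1[of S n v] by (simp add: sym)
  qed simp
  have pc: "mnorm ((S ^^ n) u) \<le> mnorm u" for n u
    by (induction n) (auto intro: order_trans[OF contr])
  have acc: "accretive ((1 - 1 / 2 ^ n) *\<^sub>R ip y y + (1 / 2 ^ n) *\<^sub>R q n - ip y (S y))" for n
  proof (induction n)
    case 0
    then show ?case using accretive_scaleR[OF accretive_ip, of 0] by (simp add: q_def)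
  next
    case (Suc n)
    define w where "w = y - (S ^^ 2 ^ n) y"
    have "ip ((S ^^ 2 ^ n) y) ((S ^^ 2 ^ n) y) = q (Suc n)"
      by (simp add: symp q_def mult_2 funpow_add)
    then have w: "ip w w = ip y y - 2 *\<^sub>R q n + q (Suc n)"
      unfolding w_def by (simp add: ip_diff_left ip_diff_right symp scaleR_2) (simp add: q_def)
    have "(1 - 1 / 2 ^ n) *\<^sub>R ip y y + (1 / 2 ^ n) *\<^sub>R q n - ip y (S y) + (1 / 2 ^ Suc n) *\<^sub>R ip w w
        = ((1 - 1 / 2 ^ n) + 1 / 2 ^ Suc n) *\<^sub>R ip y y + (1 / 2 ^ Suc n) *\<^sub>R q (Suc n) - ip y (S y)"
      unfolding w scaleR_add_right scaleR_diff_right scaleR_add_left by simp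
    moreover have "(1 - 1 / 2 ^ n) + 1 / 2 ^ Suc n = (1 - 1 / 2 ^ Suc n :: real)"
      by (simp add: field_simps)
    moreover have "accretive ((1 - 1 / 2 ^ n) *\<^sub>R ip y y + (1 / 2 ^ n) *\<^sub>R q n - ip y (S y)
        + (1 / 2 ^ Suc n) *\<^sub>R ip w w)"
      by (intro accretive_add Suc accretive_scaleR accretive_ip) simp
    ultimately show ?case by (simp only:)
  qed
  have pow: "(\<lambda>n. 1 / 2 ^ n :: real) \<longlonglongrightarrow> 0"
    using LIMSEQ_realpow_zero[of "1 / 2"] by (simp add: power_one_over)
  have "(\<lambda>n. (1 / 2 ^ n) *\<^sub>R q n) \<longlonglongrightarrow> 0"
  proof (rule Lim_null_comparison)
    have "norm (q n) \<le> mnorm y * mnorm y" for n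
      unfolding q_def by (meson norm_ip_le order_trans mult_left_mono pc mnorm_nonneg)
    then show "\<forall>\<^sub>F n in sequentially. norm ((1 / 2 ^ n) *\<^sub>R q n) \<le> (1 / 2 ^ n) * (mnorm y * mnorm y)"
      by (intro always_eventually allI) (simp add: divide_right_mono)
    show "(\<lambda>n. (1 / 2 ^ n) * (mnorm y * mnorm y)) \<longlonglongrightarrow> 0"
      using tendsto_mult_right[OF pow, of "mnorm y * mnorm y"] by simp
  qed
  then have "(\<lambda>n. (1 - 1 / 2 ^ n) *\<^sub>R ip y y + (1 / 2 ^ n) *\<^sub>R q n - ip y (S y))
      \<longlonglongrightarrow> (1 - 0) *\<^sub>R ip y y + 0 - ip y (S y)"
    by (intro tendsto_intros pow)
  then show ?thesis using accretive_limit[OF acc] by simp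
qed

lemma mnorm_adjoint_le:
  assumes adj: "\<And>u v. ip (B u) v = ip u (C v)" and bound: "\<And>u. mnorm (B u) \<le> K * mnorm u"
  shows "mnorm (C v) \<le> K * mnorm v"
proof (cases "C v = 0")
  case True
  have "0 \<le> K * mnorm v" using bound[of v] mnorm_nonneg order_trans by blast
  then show ?thesis using True mnorm_eq_0_iff[of "C v"] by simp
next
  case False
  have "mnorm (C v) * mnorm (C v) = norm (ip (B (C v)) v)"
    by (simp add: adj flip: mnorm_square power2_eq_square)
  also have "\<dots> \<le> mnorm (B (C v)) * mnorm v" by (rule norm_ip_le)
  also have "\<dots> \<le> (K * mnorm (C v)) * mnorm v" by (intro mult_right_mono bound mnorm_nonneg)
  finally have "mnorm (C v) * mnorm (C v) \<le> mnorm (C v) * (K * mnorm v)" by (simp add: mult_ac)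
  then show ?thesis using False mnorm_pos_iff[of "C v"] by simp
qed

text \<open>The norm bound \<open>\<parallel>Bu\<parallel> \<le> K\<parallel>u\<parallel>\<close> upgrades to \<open>\<langle>Bu,Bu\<rangle> \<le> K\<^sup>2\<langle>u,u\<rangle>\<close> in the algebra, because
  \<open>B\<^sup>*B/K\<^sup>2\<close> is a symmetric contraction.\<close>

lemma accretive_bounded_operator:
  assumes adj: "\<And>u v. ip (B u) v = ip u (C v)" and bound: "\<And>u. mnorm (B u) \<le> K * mnorm u"
    and "0 < K"
  shows "accretive (K\<^sup>2 *\<^sub>R ip y y - ip (B y) (B y))"
proof -
  define S where "S u = (1 / K\<^sup>2) *\<^sub>R C (B u)" for u
  have adj': "ip (C u) v = ip u (B v)" for u v by (metis adj ip_cstar)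
  have 1: "ip (S u) v = ip u (S v)" for u v
    by (simp add: S_def ip_scaleR_left ip_scaleR_right adj adj')
  have 2: "mnorm (S u) \<le> mnorm u" for u
  proof -
    have "mnorm (C (B u)) \<le> K * mnorm (B u)"
      by (rule mnorm_adjoint_le[of B C, OF adj bound])
    also have "\<dots> \<le> K * (K * mnorm u)" using bound \<open>0 < K\<close> by (intro mult_left_mono) auto
    finally show ?thesis
      using \<open>0 < K\<close> by (simp add: S_def mnorm_scaleR field_simps power2_eq_square)
  qed
  have "accretive (ip y y - ip y (S y))"
    by (rule accretive_ip_diff_contraction[of S, OF 1 2])
  then have "accretive (K\<^sup>2 *\<^sub>R (ip y y - ip y (S y)))" by (rule accretive_scaleR) simp
  moreover have "K\<^sup>2 *\<^sub>R (ip y y - ip y (S y)) = K\<^sup>2 *\<^sub>R ip y y - ip (B y) (B y)"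
    using \<open>0 < K\<close> by (simp add: S_def ip_scaleR_right adj scaleR_diff_right)
  ultimately show ?thesis by simp
qed

text \<open>With the notation of the proof and in terms of the order,
  \<open>\<sigma>e \<le> se\<close> and \<open>(\<sigma>/M)q \<le> \<sigma>e\<close> give \<open>p = q - se + d \<le> (1 - \<sigma>/M)q + d\<close>. Since \<open>\<parallel>q\<parallel> \<le> \<parallel>p\<parallel>\<close>, it
  follows that \<open>(\<sigma>/M)\<parallel>q\<parallel> \<le> \<parallel>d\<parallel>\<close>. Then \<open>\<sigma>e \<le> q + d\<close>, which holds as \<open>p \<ge> 0\<close>, bounds \<open>\<parallel>e\<parallel> = \<parallel>y\<parallel>\<^sup>2\<close>
  by a multiple of \<open>\<parallel>d\<parallel> \<le> \<parallel>y\<parallel> \<parallel>w\<parallel>\<close>. The constant is uniform in \<open>s \<ge> \<sigma>\<close>, as is needed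
  for moving along a ray.\<close>

lemma mnorm_shift_ge:
  assumes adj: "\<And>u v. ip (A u) v = ip u (A' v)" and bound: "\<And>u. mnorm (A u) \<le> K * mnorm u"
    and "0 < K" and dom: "\<And>u. mnorm (A u) \<le> mnorm (A' u)" and "0 < \<sigma>"
  shows "\<exists>c>0. \<forall>s\<ge>\<sigma>. \<forall>y. c * mnorm y \<le> mnorm (A (A' y) - A' (A y) + s *\<^sub>R y)"
proof -
  \<comment> \<open>Any bound above \<open>K\<^sup>2\<close> is admissible; adding \<open>\<sigma>\<close> makes \<open>1 - \<sigma>/M\<close> positive.\<close>
  define M where "M = K\<^sup>2 + \<sigma>"
  have M: "0 < M" "\<sigma> < M" using \<open>0 < K\<close> \<open>0 < \<sigma>\<close> by (simp_all add: M_def add_pos_pos)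
  have adj': "ip (A' u) v = ip u (A v)" for u v by (metis adj ip_cstar)
  have "\<sigma> / (M / \<sigma> + 1) * mnorm y \<le> mnorm (A (A' y) - A' (A y) + s *\<^sub>R y)" if s: "\<sigma> \<le> s" for s y
  proof (cases "y = 0")
    case True
    then show ?thesis using mnorm_eq_0_iff[of y] mnorm_nonneg by simp
  next
    case False
    define w p q e where "w = A (A' y) - A' (A y) + s *\<^sub>R y"
      and "p = ip (A' y) (A' y)" and "q = ip (A y) (A y)" and "e = ip y y"
    define d where "d = ip y w"
    have d: "d = p - q + s *\<^sub>R e"
      by (simp add: d_def w_def p_def q_def e_def ip_add_right ip_diff_right ip_scaleR_right adj adj')
    have acc: "accretive p" "accretive q" "accretive e"
      by (simp_all add: p_def q_def e_def accretive_ip)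
    have sa: "p\<^sup>\<star> = p" "q\<^sup>\<star> = q" "e\<^sup>\<star> = e"
      using acc by (simp_all add: accretive_def)
    have acc0: "accretive (0 + a)" if "accretive a" for a :: 'a using that by simp
    have "accretive (K\<^sup>2 *\<^sub>R e - q + \<sigma> *\<^sub>R e)"
      unfolding q_def e_def using \<open>0 < \<sigma>\<close>
      by (intro accretive_add accretive_scaleR accretive_ip
          accretive_bounded_operator[of A A', OF adj bound \<open>0 < K\<close>]) simp
    then have Meq: "accretive (M *\<^sub>R e - q)" by (simp add: M_def algebra_simps)
    have slack: "accretive ((s - \<sigma>) *\<^sub>R e)" using acc(3) s by (intro accretive_scaleR) auto
    have norm_qp: "norm q \<le> norm p"
      using dom[of y] mnorm_nonneg unfolding p_def q_def
      by (simp flip: mnorm_square add: power_mono)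
    have "norm p \<le> (1 - \<sigma> / M) * norm q + norm d"
    proof (rule norm_le_if_accretive)
      have "accretive ((\<sigma> / M) *\<^sub>R (M *\<^sub>R e - q) + (s - \<sigma>) *\<^sub>R e)"
        using M \<open>0 < \<sigma>\<close> by (intro accretive_add accretive_scaleR Meq slack) simp
      moreover have "(\<sigma> / M) *\<^sub>R (M *\<^sub>R e - q) + (s - \<sigma>) *\<^sub>R e = (1 - \<sigma> / M) *\<^sub>R q + d - p"
        using M by (simp add: d algebra_simps)
      ultimately show "accretive ((1 - \<sigma> / M) *\<^sub>R q + d - p)" by simp
      show "norm ((1 - \<sigma> / M) *\<^sub>R q + d) \<le> (1 - \<sigma> / M) * norm q + norm d"
        using norm_triangle_ineq[of "(1 - \<sigma> / M) *\<^sub>R q" d] M by simp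
      show "norm 0 \<le> (1 - \<sigma> / M) * norm q + norm d" using M by simp
    qed (use acc0 acc sa in auto)
    then have "(\<sigma> / M) * norm q \<le> norm d" using norm_qp by (simp add: algebra_simps)
    then have q: "norm q \<le> M / \<sigma> * norm d"
      using M \<open>0 < \<sigma>\<close> by (simp add: field_simps)
    have "norm (\<sigma> *\<^sub>R e) \<le> norm q + norm d"
    proof (rule norm_le_if_accretive)
      have "q + d - \<sigma> *\<^sub>R e = p + (s - \<sigma>) *\<^sub>R e" by (simp add: d algebra_simps)
      then show "accretive (q + d - \<sigma> *\<^sub>R e)" using accretive_add[OF acc(1) slack] by simp
      show "accretive (0 + \<sigma> *\<^sub>R e)" using acc(3) \<open>0 < \<sigma>\<close> by (intro acc0 accretive_scaleR) auto
    qed (auto simp: cstar_scaleR sa norm_triangle_ineq)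
    then have "\<sigma> * norm e \<le> (M / \<sigma> + 1) * norm d"
      using q \<open>0 < \<sigma>\<close> by (simp add: algebra_simps)
    also have "\<dots> \<le> (M / \<sigma> + 1) * (mnorm y * mnorm w)"
      unfolding d_def using M \<open>0 < \<sigma>\<close> by (intro mult_left_mono norm_ip_le) auto
    finally have "mnorm y * (\<sigma> * mnorm y) \<le> mnorm y * ((M / \<sigma> + 1) * mnorm w)"
      by (simp add: e_def power2_eq_square mult_ac flip: mnorm_square)
    then have "\<sigma> * mnorm y \<le> (M / \<sigma> + 1) * mnorm w" using False mnorm_pos_iff[of y] by simp
    moreover have "0 < M / \<sigma> + 1" using M \<open>0 < \<sigma>\<close> by (simp add: add_pos_pos)
    ultimately show ?thesis by (simp add: w_def divide_le_eq mult_ac)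
  qed
  moreover have "0 < \<sigma> / (M / \<sigma> + 1)" using M \<open>0 < \<sigma>\<close> by (simp add: add_pos_pos)
  ultimately show ?thesis by blast
qed

text \<open>Since \<open>\<langle>y,Ty\<rangle>\<close> is self-adjoint, the imaginary part of \<open>\<langle>y,(T - z)y\<rangle>\<close> is \<open>-Im z \<langle>y,y\<rangle>\<close>.\<close>

lemma mnorm_nonreal_shift_ge:
  assumes sym: "\<And>u v. ip (T u) v = ip u (T v)"
  shows "\<bar>Im z\<bar> * mnorm y \<le> mnorm (T y - z *\<^sub>C y)"
proof (cases "y = 0")
  case True
  then show ?thesis using mnorm_eq_0_iff[of y] mnorm_nonneg by simp
next
  case False
  define b where "b = ip y (T y - z *\<^sub>C y)"
  have "b\<^sup>\<star> = ip (T y - z *\<^sub>C y) y" by (simp add: b_def ip_cstar)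
  then have "b\<^sup>\<star> - b = (z - cnj z) *\<^sub>C ip y y"
    by (simp add: b_def ip_diff_left ip_diff_right ip_scaleC_left ip_scaleC_right sym scaleC_diff_left)
  then have "norm (b\<^sup>\<star> - b) = 2 * \<bar>Im z\<bar> * (mnorm y)\<^sup>2"
    by (simp add: norm_scaleC mnorm_square complex_diff_cnj norm_mult)
  then have "\<bar>Im z\<bar> * (mnorm y)\<^sup>2 \<le> norm b"
    using norm_triangle_ineq4[of "b\<^sup>\<star>" b] by (simp add: norm_cstar)
  also have "\<dots> \<le> mnorm y * mnorm (T y - z *\<^sub>C y)" unfolding b_def by (rule norm_ip_le)
  finally have "mnorm y * (\<bar>Im z\<bar> * mnorm y) \<le> mnorm y * mnorm (T y - z *\<^sub>C y)"
    by (simp add: power2_eq_square mult_ac)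
  then show ?thesis using False mnorm_pos_iff[of y] by simp
qed

section \<open>Invertibility along a ray\<close>

text \<open>The Neumann series. Solving \<open>S y\<^sub>0 = v\<close> leaves the residual \<open>-B y\<^sub>0\<close>, of at most half the norm
  of \<open>v\<close>. Repeating this with the residual in place of \<open>v\<close> and adding up the solutions gives a
  convergent series.\<close>

lemma surj_perturbation:
  assumes S: "\<And>u v. S (u + v) = S u + S v" "\<And>u. mnorm (S u) \<le> L * mnorm u" "surj S"
    and "0 < c" and lower: "\<And>u. c * mnorm u \<le> mnorm (S u)"
    and B: "\<And>u v. B (u + v) = B u + B v" "\<And>u. mnorm (B u) \<le> c / 2 * mnorm u"
  shows "surj (\<lambda>u. S u + B u)"
proof (rule surjI)
  fix v
  define R where "R = inv S"
  have SR: "S (R u) = u" for u unfolding R_def by (rule surj_f_inv_f[OF S(3)])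
  define r where "r n = ((\<lambda>u. - B (R u)) ^^ n) v" for n
  define X where "X n = (\<Sum>k<n. R (r k))" for n
  have mR: "mnorm (R u) \<le> mnorm u / c" for u
    using lower[of "R u"] \<open>0 < c\<close> by (simp add: SR field_simps)
  have mr: "mnorm (r n) \<le> mnorm v / 2 ^ n" for n
  proof (induction n)
    case 0
    then show ?case by (simp add: r_def)
  next
    case (Suc n)
    have "mnorm (r (Suc n)) = mnorm (B (R (r n)))" by (simp add: r_def mnorm_minus)
    also have "\<dots> \<le> c / 2 * (mnorm (r n) / c)"
      using \<open>0 < c\<close> mR by (intro order_trans[OF B(2)] mult_left_mono) auto
    also have "\<dots> \<le> mnorm v / 2 ^ Suc n" using Suc \<open>0 < c\<close> by simp
    finally show ?case .
  qed
  define D where "D = mnorm v / c"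
  have D: "0 \<le> D" using \<open>0 < c\<close> by (simp add: D_def mnorm_nonneg)
  have y: "mnorm (R (r n)) \<le> D / 2 ^ n" for n
    using mR[of "r n"] divide_right_mono[OF mr[of n], of c] \<open>0 < c\<close> by (simp add: D_def mult.commute)
  have X_tail: "mnorm (X (n + j) - X n) \<le> 2 * D / 2 ^ n - 2 * D / 2 ^ (n + j)" for n j
  proof (induction j)
    case 0
    then show ?case using mnorm_eq_0_iff[of 0] by simp
  next
    case (Suc j)
    have "X (n + Suc j) - X n = (X (n + j) - X n) + R (r (n + j))" by (simp add: X_def)
    then have "mnorm (X (n + Suc j) - X n) \<le> mnorm (X (n + j) - X n) + mnorm (R (r (n + j)))"
      by (metis mnorm_triangle)
    moreover have "2 * D / 2 ^ (n + Suc j) = 2 * D / 2 ^ (n + j) - D / 2 ^ (n + j)"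
      by simp
    ultimately show ?case using Suc y[of "n + j"] by linarith
  qed
  have pow: "(\<lambda>n. a / 2 ^ n :: real) \<longlonglongrightarrow> 0" for a
  proof -
    have "(\<lambda>n. a * (1 / 2) ^ n) \<longlonglongrightarrow> a * 0"
      by (intro tendsto_mult_left LIMSEQ_realpow_zero) simp_all
    then show ?thesis by (simp add: power_divide)
  qed
  have "\<exists>l. (\<lambda>n. mnorm (X n - l)) \<longlonglongrightarrow> 0"
  proof (rule complete_module_norm, intro allI impI)
    fix \<epsilon> :: real
    assume "0 < \<epsilon>"
    then obtain N where N: "2 * D / 2 ^ n < \<epsilon>" if "N \<le> n" for n
      using order_tendstoD(2)[OF pow[of "2 * D"]] unfolding eventually_sequentially by metis
    have le: "mnorm (X m - X n) < \<epsilon>" if "N \<le> n" "n \<le> m" for m n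
    proof -
      have "mnorm (X m - X n) \<le> 2 * D / 2 ^ n - 2 * D / 2 ^ m"
        using X_tail[of n "m - n"] that by simp
      also have "\<dots> \<le> 2 * D / 2 ^ n" using D by simp
      finally show ?thesis using N[OF that(1)] by simp
    qed
    have "mnorm (X m - X n) < \<epsilon>" if "N \<le> m" "N \<le> n" for m n
      using le[of n m] le[of m n] that mnorm_minus[of "X m - X n"] by (cases "n \<le> m") auto
    then show "\<exists>M. \<forall>m\<ge>M. \<forall>n\<ge>M. mnorm (X m - X n) < \<epsilon>" by blast
  qed
  then obtain l where l: "(\<lambda>n. mnorm (X n - l)) \<longlonglongrightarrow> 0" by blast
  define F where "F u = S u + B u" for u
  have F_add: "F (u + w) = F u + F w" for u w by (simp add: F_def S(1) B(1))
  have F_diff: "F (u - w) = F u - F w" for u w using F_add[of "u - w" w] by simp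
  have FX: "F (X n) = v - r n" for n
  proof (induction n)
    case 0
    then show ?case using F_diff[of 0 0] by (simp add: X_def r_def)
  next
    case (Suc n)
    have "F (X (Suc n)) = F (X n) + F (R (r n))" by (simp add: X_def F_add)
    then show ?case using Suc by (simp add: F_def SR) (simp add: r_def)
  qed
  have "(\<lambda>n. (L + c / 2) * mnorm (X n - l) + mnorm v / 2 ^ n) \<longlonglongrightarrow> (L + c / 2) * 0 + 0"
    by (intro tendsto_intros l pow)
  moreover have "mnorm (F l - v) \<le> (L + c / 2) * mnorm (X n - l) + mnorm v / 2 ^ n" for n
  proof -
    have "F l - v = - (F (X n - l) + r n)" by (simp add: F_diff FX)
    then have "mnorm (F l - v) \<le> mnorm (F (X n - l)) + mnorm (r n)"
      by (metis mnorm_minus mnorm_triangle)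
    also have "mnorm (F (X n - l)) \<le> mnorm (S (X n - l)) + mnorm (B (X n - l))"
      unfolding F_def by (rule mnorm_triangle)
    finally show ?thesis
      using S(2)[of "X n - l"] B(2)[of "X n - l"] mr[of n] by (simp add: algebra_simps)
  qed
  ultimately have "mnorm (F l - v) \<le> 0"
    by (intro LIMSEQ_le_const[of _ 0]) auto
  then have "F l = v" using mnorm_nonneg[of "F l - v"] mnorm_eq_0_iff[of "F l - v"] by simp
  then show "S (SOME u. S u + B u = v) + B (SOME u. S u + B u = v) = v"
    unfolding F_def by (rule someI)
qed

text \<open>The parameter \<open>t0\<close> is so large that \<open>T\<close> is a small perturbation of the scalar
  \<open>-\<mu> = -(z + t0 \<theta>)\<close>. From there one walks back to \<open>t = 0\<close> in steps of length \<open>c/2\<close>.\<close>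

lemma surj_shift_along_ray:
  assumes add: "\<And>u v. T (u + v) = T u + T v" and bound: "\<And>u. mnorm (T u) \<le> K * mnorm u"
    and "cmod \<theta> = 1" and "0 < c"
    and lower: "\<And>t u. 0 \<le> t \<Longrightarrow> c * mnorm u \<le> mnorm (T u - (z + of_real t * \<theta>) *\<^sub>C u)"
  shows "surj (\<lambda>u. T u - z *\<^sub>C u)"
proof -
  define F where "F t u = T u - (z + of_real t * \<theta>) *\<^sub>C u" for t :: real and u
  define t0 where "t0 = \<bar>2 * K\<bar> + cmod z + 1"
  define \<mu> where "\<mu> = z + of_real t0 * \<theta>"
  have t0: "0 \<le> t0" by (simp add: t0_def add_nonneg_nonneg)
  have "t0 = cmod (\<mu> - z)"
    using t0 \<open>cmod \<theta> = 1\<close> by (simp add: \<mu>_def norm_mult)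
  then have \<mu>: "2 * K \<le> cmod \<mu>" "0 < cmod \<mu>"
    using norm_triangle_ineq4[of \<mu> z] unfolding t0_def by auto
  then have \<mu>0: "\<mu> \<noteq> 0" by auto
  have "surj (\<lambda>u. (- \<mu>) *\<^sub>C u + T u)"
  proof (rule surj_perturbation[where c = "cmod \<mu>" and L = "cmod \<mu>"])
    show "surj (\<lambda>u. (- \<mu>) *\<^sub>C u :: 'h)"
      using \<mu>0 by (intro surjI[of _ "\<lambda>u. (- 1 / \<mu>) *\<^sub>C u"]) (simp add: scaleC_scaleC scaleC_one)
    show "mnorm (T u) \<le> cmod \<mu> / 2 * mnorm u" for u
      using bound[of u] mult_right_mono[OF \<mu>(1) mnorm_nonneg[of u]] by simp
  qed (use \<mu> in \<open>simp_all add: add scaleC_add_right mnorm_scaleC\<close>)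
  then have start: "surj (F t0)"
    by (simp add: F_def[abs_def] scaleC_minus_left flip: \<mu>_def)
  have step: "surj (F t')" if t: "surj (F t)" "0 \<le> t" "\<bar>t - t'\<bar> \<le> c / 2" for t t'
  proof -
    have "surj (\<lambda>u. F t u + (of_real (t - t') * \<theta>) *\<^sub>C u)"
    proof (rule surj_perturbation[where c = c and L = "K + cmod (z + of_real t * \<theta>)"])
      show "F t (u + v) = F t u + F t v" for u v by (simp add: F_def add scaleC_add_right)
      show "mnorm (F t u) \<le> (K + cmod (z + of_real t * \<theta>)) * mnorm u" for u
        unfolding F_def
        using mnorm_triangle_diff[of "T u" "(z + of_real t * \<theta>) *\<^sub>C u"] bound[of u]
        by (simp add: mnorm_scaleC distrib_right)
      show "c * mnorm u \<le> mnorm (F t u)" for u unfolding F_def by (rule lower[OF t(2)])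
      show "mnorm ((of_real (t - t') * \<theta>) *\<^sub>C u) \<le> c / 2 * mnorm u" for u
        unfolding mnorm_scaleC norm_mult norm_of_real \<open>cmod \<theta> = 1\<close>
        using mult_right_mono[OF t(3) mnorm_nonneg[of u]] by simp
    qed (use t \<open>0 < c\<close> in \<open>simp_all add: scaleC_add_right\<close>)
    moreover have "F t u + (of_real (t - t') * \<theta>) *\<^sub>C u = F t' u" for u
      by (simp add: F_def scaleC_add_left scaleC_diff_left left_diff_distrib)
    ultimately show ?thesis by simp
  qed
  have all: "surj (F (max 0 (t0 - of_nat n * (c / 2))))" for n
  proof (induction n)
    case 0
    then show ?case using start t0 by simp
  next
    case (Suc n)
    then show ?case
      by (rule step) (use \<open>0 < c\<close> in \<open>auto simp: algebra_simps max_def\<close>)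
  qed
  obtain n where "t0 / (c / 2) < of_nat n" using reals_Archimedean2 by blast
  then have "max 0 (t0 - of_nat n * (c / 2)) = 0" using \<open>0 < c\<close> by (simp add: field_simps)
  then have "surj (F 0)" using all[of n] by simp
  then show ?thesis by (simp add: F_def[abs_def])
qed

lemma adjointable_linear:
  assumes adj: "\<And>u v. ip (B u) v = ip u (C v)"
  shows "B (u + v) = B u + B v" and "B (c *\<^sub>C u) = c *\<^sub>C B u"
proof -
  have adj': "ip (C u) v = ip u (B v)" for u v by (metis adj ip_cstar)
  show "B (u + v) = B u + B v"
    by (rule ip_ext) (simp add: ip_add_right flip: adj')
  show "B (c *\<^sub>C u) = c *\<^sub>C B u"
    by (rule ip_ext) (simp add: ip_scaleC_right flip: adj')
qed

section \<open>Cohyponormality from norm inequalities\<close>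

text \<open>A point \<open>z\<close> outside \<open>[0,\<infinity>)\<close> is joined to infinity by a ray along which \<open>T\<close> stays bounded
  below uniformly: vertically away from the real axis if \<open>z\<close> is not real, to the left if \<open>z < 0\<close>.
  So \<open>T - z\<close> is bijective, and the same holds for the conjugate of \<open>z\<close>. The inverses of these two
  mutually adjoint operators are adjoint to each other, which makes the inverse of \<open>T - z\<close>
  adjointable.\<close>

lemma op_positive_if_bounded_below:
  assumes sym: "\<And>u v. ip (T u) v = ip u (T v)" and bound: "\<And>u. mnorm (T u) \<le> K * mnorm u"
    and lower: "\<And>\<sigma>. 0 < \<sigma> \<Longrightarrow> \<exists>c>0. \<forall>s\<ge>\<sigma>. \<forall>y. c * mnorm y \<le> mnorm (T y + s *\<^sub>R y)"
  shows "op_positive ip T"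
proof -
  have bij: "bij (\<lambda>u. T u - z *\<^sub>C u)" if z: "z \<notin> \<real>\<^sub>\<ge>\<^sub>0" for z
  proof -
    obtain \<theta> c where \<theta>: "cmod \<theta> = 1" and c: "0 < c"
      and low: "\<And>t u. 0 \<le> t \<Longrightarrow> c * mnorm u \<le> mnorm (T u - (z + of_real t * \<theta>) *\<^sub>C u)"
    proof (cases "Im z = 0")
      case True
      then have "Re z < 0" using z by (auto simp: complex_nonneg_Reals_iff)
      then obtain c where c: "0 < c" "\<And>s y. - Re z \<le> s \<Longrightarrow> c * mnorm y \<le> mnorm (T y + s *\<^sub>R y)"
        using lower[of "- Re z"] by auto
      have eq: "T u - (z + of_real t * (- 1)) *\<^sub>C u = T u + (t - Re z) *\<^sub>R u" for t u
      proof -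
        have "z + of_real t * (- 1) = - complex_of_real (t - Re z)"
          using True by (simp add: complex_eq_iff)
        then show ?thesis by (simp only: scaleC_minus_left scaleR_scaleC) simp
      qed
      show thesis
        by (rule that[of "- 1" c], simp, rule c(1), unfold eq, rule c(2)) simp
    next
      case False
      show thesis
      proof (rule that[of "\<i> * of_real (sgn (Im z))" "\<bar>Im z\<bar>"])
        fix t :: real and u
        assume "0 \<le> t"
        then have "\<bar>Im z\<bar> \<le> \<bar>Im (z + of_real t * (\<i> * of_real (sgn (Im z))))\<bar>"
          by (simp add: sgn_if)
        then show "\<bar>Im z\<bar> * mnorm u
            \<le> mnorm (T u - (z + of_real t * (\<i> * of_real (sgn (Im z)))) *\<^sub>C u)"
          by (meson mnorm_nonreal_shift_ge[OF sym] mult_right_mono mnorm_nonneg order_trans)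
      qed (use False in \<open>simp_all add: norm_mult sgn_if\<close>)
    qed
    have "inj (\<lambda>u. T u - z *\<^sub>C u)"
    proof (rule injI)
      fix u v
      assume eq: "T u - z *\<^sub>C u = T v - z *\<^sub>C v"
      have "T u = T (u - v) + T v" using adjointable_linear(1)[OF sym, of "u - v" v] by simp
      then have "T (u - v) - z *\<^sub>C (u - v) = 0"
        using eq by (simp add: scaleC_diff_right algebra_simps)
      then have "c * mnorm (u - v) \<le> 0"
        using low[of 0 "u - v"] mnorm_eq_0_iff[of 0] by simp
      then show "u = v"
        using c mnorm_pos_iff[of "u - v"] by (auto simp: mult_le_0_iff not_le less_le)
    qed
    moreover have "surj (\<lambda>u. T u - z *\<^sub>C u)"
      by (rule surj_shift_along_ray[OF adjointable_linear(1)[OF sym] bound \<theta> c low])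
    ultimately show ?thesis by (rule bijI)
  qed
  have "op_spectrum ip T \<subseteq> \<real>\<^sub>\<ge>\<^sub>0"
  proof (rule ccontr)
    assume "\<not> op_spectrum ip T \<subseteq> \<real>\<^sub>\<ge>\<^sub>0"
    then obtain z where z: "z \<in> op_spectrum ip T" "z \<notin> \<real>\<^sub>\<ge>\<^sub>0" by auto
    then have z': "cnj z \<notin> \<real>\<^sub>\<ge>\<^sub>0" by (simp add: complex_nonneg_Reals_iff)
    define F G where "F u = T u - z *\<^sub>C u" and "G u = T u - cnj z *\<^sub>C u" for u
    have F: "bij F" and G: "bij G" using bij[OF z(2)] bij[OF z'] by (simp_all add: F_def[abs_def] G_def[abs_def])
    have FG: "ip (F u) v = ip u (G v)" for u v
      by (simp add: F_def G_def ip_diff_left ip_diff_right ip_scaleC_left ip_scaleC_right sym)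
    have "ip (inv F u) v = ip u (inv G v)" for u v
      by (metis FG F G bij_inv_eq_iff)
    then have "adjointable ip (inv F)" unfolding adjointable_def by blast
    moreover have "inv F \<circ> F = id" "F \<circ> inv F = id"
      using F by (auto simp: fun_eq_iff bij_is_inj bij_is_surj surj_f_inv_f)
    ultimately show False
      using z(1) unfolding op_spectrum_def F_def[abs_def] by blast
  qed
  moreover have adjT: "adjointable ip T" using sym unfolding adjointable_def by blast
  moreover have "module_adjoint ip T = T"
  proof
    show "module_adjoint ip T u = T u" for u
      by (rule ip_ext) (simp add: sym flip: module_adjoint[OF adjT])
  qed
  ultimately show ?thesis by (simp add: op_positive_def)
qed

lemma cohyponormal_if_mnorm_le:
  assumes A: "adjointable ip A" and bound: "\<And>u. mnorm (A u) \<le> K * mnorm u"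
    and dom: "\<And>u. mnorm (A u) \<le> mnorm (module_adjoint ip A u)"
  shows "cohyponormal ip A"
proof -
  define A' where "A' = module_adjoint ip A"
  have adj: "ip (A u) v = ip u (A' v)" for u v
    unfolding A'_def by (rule module_adjoint[OF A])
  have adj': "ip (A' u) v = ip u (A v)" for u v by (metis adj ip_cstar)
  define L where "L = max K 1"
  have L: "0 < L" by (simp add: L_def)
  have bL: "mnorm (A u) \<le> L * mnorm u" for u
    using bound[of u] mult_right_mono[of K L "mnorm u"] mnorm_nonneg[of u] by (simp add: L_def)
  have bL': "mnorm (A' u) \<le> L * mnorm u" for u
    by (rule mnorm_adjoint_le[of A A', OF adj bL])
  have "op_positive ip (\<lambda>u. A (A' u) - A' (A u))"
  proof (rule op_positive_if_bounded_below[where K = "L * L + L * L"])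
    show "ip (A (A' u) - A' (A u)) v = ip u (A (A' v) - A' (A v))" for u v
      by (simp add: ip_diff_left ip_diff_right adj adj')
    show "mnorm (A (A' u) - A' (A u)) \<le> (L * L + L * L) * mnorm u" for u
    proof -
      have "mnorm (A (A' u)) \<le> L * (L * mnorm u)" "mnorm (A' (A u)) \<le> L * (L * mnorm u)"
        using L by (meson bL bL' mult_left_mono order_trans less_imp_le)+
      then show ?thesis
        using mnorm_triangle_diff[of "A (A' u)" "A' (A u)"] by (simp add: algebra_simps)
    qed
    show "\<exists>c>0. \<forall>s\<ge>\<sigma>. \<forall>y. c * mnorm y \<le> mnorm (A (A' y) - A' (A y) + s *\<^sub>R y)"
      if "0 < \<sigma>" for \<sigma>
      by (rule mnorm_shift_ge[OF adj bL L _ that]) (use dom in \<open>simp add: A'_def\<close>)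
  qed
  then show ?thesis by (simp add: cohyponormal_def op_le_def A'_def)
qed

end

text \<open>If \<open>p\<close> is a weighted geometric mean of \<open>r\<close> and \<open>q\<close>, then replacing \<open>r\<close> by the smaller number
  \<open>p\<close> gives \<open>p\<^sup>\<lambda> q\<^sup>1\<^sup>-\<^sup>\<lambda> \<le> p = p\<^sup>\<lambda> p\<^sup>1\<^sup>-\<^sup>\<lambda>\<close>.\<close>

lemma weighted_geometric_mean_le:
  fixes p q r lam :: real
  assumes "p = r powr lam * q powr (1 - lam)" and lam: "0 < lam" "lam < 1"
    and "p \<le> r" "0 < r" "0 \<le> q"
  shows "q \<le> p"
proof (cases "q = 0")
  case True
  then show ?thesis using assms by simp
next
  case False
  then have "0 < q" "0 < p" using assms by simp_all
  have "p powr lam * q powr (1 - lam) \<le> p"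
    using assms \<open>0 < p\<close> by (metis less_imp_le mult_right_mono powr_ge_zero powr_mono2)
  also have "p = p powr lam * p powr (1 - lam)"
    using \<open>0 < p\<close> by (simp flip: powr_add)
  finally have "q powr (1 - lam) \<le> p powr (1 - lam)" using \<open>0 < p\<close> by simp
  then show ?thesis
    using \<open>0 < p\<close> \<open>0 < q\<close> lam powr_less_mono2[of "1 - lam" p q] by (force simp: not_le[symmetric])
qed

theorem theorem2p19:
  fixes ract :: "'h::complex_vector \<Rightarrow> 'a::cstar_algebra \<Rightarrow> 'h"
    and ip :: "'h \<Rightarrow> 'h \<Rightarrow> 'a"
    and A :: "'h \<Rightarrow> 'h"
    and x :: 'h
  assumes "hilbert_module ract ip"
    and "adjointable ip A"
    and "A x \<noteq> 0"
    and "\<And>y. \<exists>lam\<in>{0<..<1::real}.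
           norm (ip (A x) y) =
             (module_norm ip (A x) * module_norm ip y) powr lam *
             (module_norm ip (A y) * module_norm ip x) powr (1 - lam)"
  shows "cohyponormal ip A"
proof -
  interpret hilbert_module ract ip by fact
  have adj: "ip (A u) v = ip u (module_adjoint ip A v)" for u v
    by (rule module_adjoint[OF assms(2)])
  have A0: "A 0 = 0"
    using adjointable_linear(1)[of A "module_adjoint ip A" 0 0, OF adj] by simp
  then have "x \<noteq> 0" using assms(3) by auto
  then have x: "0 < mnorm x" by (simp add: mnorm_pos_iff)
  have Ax: "0 < mnorm (A x)" using assms(3) by (simp add: mnorm_pos_iff)
  have main: "mnorm (A y) * mnorm x \<le> norm (ip (A x) y)" for y
  proof (cases "y = 0")
    case True
    then show ?thesis using A0 mnorm_eq_0_iff[of 0] by simp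
  next
    case False
    obtain lam where lam: "0 < lam" "lam < 1"
      and eq: "norm (ip (A x) y) = (mnorm (A x) * mnorm y) powr lam * (mnorm (A y) * mnorm x) powr (1 - lam)"
      using assms(4)[of y] by auto
    show ?thesis
      by (rule weighted_geometric_mean_le[OF eq lam norm_ip_le])
        (use Ax False in \<open>simp_all add: mnorm_pos_iff mnorm_nonneg\<close>)
  qed
  show ?thesis
  proof (rule cohyponormal_if_mnorm_le[OF assms(2)])
    show "mnorm (A y) \<le> mnorm (A x) / mnorm x * mnorm y" for y
      using order_trans[OF main[of y] norm_ip_le[of "A x" y]] x by (simp add: field_simps)
    show "mnorm (A y) \<le> mnorm (module_adjoint ip A y)" for y
      using order_trans[OF main[of y, unfolded adj] norm_ip_le] x by (simp add: mult.commute)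
  qed
qed

end
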